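(* Let $r>0$, let $T:\mathbb{R}^N\to\mathbb{R}^M$ and $\mathcal{Q}:\mathbb{R}^N\to\mathbb{R}^{M'}$ be linear operators, and let $g\in\mathbb{R}^M$. For any real parameter $p\ge1$, the constrained minimization problem $$\text{Minimize }\ \mathcal{J}_r^p(u)=\|Tu-g\|_{\ell_2^M}^2+\sum_{i=1}^N\min\{|u_i|^p,r^p\}\quad\text{subject to }\ \mathcal{Q}u=0$$ has minimizers $u^*\in\mathbb{R}^N$.
   Context: $\|\cdot\|_{\ell_2^M}$ is the Euclidean norm on $\mathbb{R}^M$. *)

theory Defs
  imports "HOL-Analysis.Analysis"
begin

text \<open>Since \<open>0 powr p = 0\<close>, the real power of \<open>\<bar>u $ i\<bar>\<close> is the intended one for every real
  \<open>p \<ge> 1\<close>, also at vanishing components.\<close>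

definition J_trunc ::
  "real \<Rightarrow> real \<Rightarrow> (real ^ 'n \<Rightarrow> real ^ 'm) \<Rightarrow> real ^ 'm \<Rightarrow> real ^ 'n \<Rightarrow> real" where
  "J_trunc r p T g u = (norm (T u - g))\<^sup>2 + (\<Sum>i\<in>UNIV. min (\<bar>u $ i\<bar> powr p) (r powr p))"

end

theory Submission
  imports Defs
begin

text \<open>For every set \<open>S\<close> of indices, replace the summand \<open>min {\<bar>u\<^sub>i\<bar>\<^sup>p, r\<^sup>p}\<close> by \<open>\<bar>u\<^sub>i\<bar>\<^sup>p\<close> if \<open>i \<in> S\<close> and by
  \<open>r\<^sup>p\<close> otherwise. The objective is the pointwise minimum of these finitely many functionals, so it
  suffices to minimize each of them. A single one need not be coercive in \<open>u\<close>, but it factors through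
  the linear map \<open>u \<mapsto> (T u, u\<restriction>S)\<close>: it is a continuous coercive function on the image of \<open>ker Q\<close>,
  which is closed because it is a finite-dimensional subspace.\<close>

text \<open>The bound gives \<open>f\<close> at least linear growth, so the sublevel set of any
  point of \<open>W\<close> is bounded, hence compact, and the extreme value theorem applies
  there.\<close>

lemma attains_inf_coercive:
  fixes f :: "'a::euclidean_space \<Rightarrow> real"
  assumes "closed W" "W \<noteq> {}" "continuous_on W f"
    and bound: "\<And>w. w \<in> W \<Longrightarrow> norm w \<le> C + f w"
  obtains w where "w \<in> W" "\<And>v. v \<in> W \<Longrightarrow> f w \<le> f v"
proof -
  obtain w0 where w0: "w0 \<in> W" using assms(2) by blast
  define K where "K = {w \<in> W. f w \<le> f w0}"
  have "closed K"
    unfolding K_def using assms(1,3) by (intro continuous_on_closed_Collect_le continuous_on_const)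
  moreover have "bounded K"
    unfolding bounded_iff K_def using bound by (intro exI[of _ "C + f w0"]) force
  ultimately have "compact K" by (simp add: compact_eq_bounded_closed)
  moreover have "K \<noteq> {}" using w0 by (auto simp: K_def)
  moreover have "continuous_on K f"
    using assms(3) by (rule continuous_on_subset) (auto simp: K_def)
  ultimately obtain w where "w \<in> K" "\<forall>v\<in>K. f w \<le> f v"
    using continuous_attains_inf by blast
  then show thesis
    using that[of w] unfolding K_def by force
qed

text \<open>Turns powers into linear growth; used with exponent 2 for the residual and with
  \<open>p\<close> for the components.\<close>

lemma le_one_plus_powr:
  fixes x p :: real
  assumes "0 \<le> x" "1 \<le> p"
  shows "x \<le> 1 + x powr p"
proof (cases "x \<le> 1")
  case False
  then have "x powr 1 \<le> x powr p" using assms by (intro powr_mono) auto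
  then show ?thesis using False by simp
qed (simp add: add_increasing2)

definition J_fixed ::
  "'n set \<Rightarrow> real \<Rightarrow> real \<Rightarrow> (real ^ 'n \<Rightarrow> real ^ 'm) \<Rightarrow> real ^ 'm \<Rightarrow> real ^ 'n \<Rightarrow> real" where
  "J_fixed S r p T g u =
     (norm (T u - g))\<^sup>2 + (\<Sum>i\<in>UNIV. if i \<in> S then \<bar>u $ i\<bar> powr p else r powr p)"

lemma J_trunc_le_J_fixed: "J_trunc r p T g u \<le> J_fixed S r p T g u"
  unfolding J_trunc_def J_fixed_def by (intro add_left_mono sum_mono) auto

text \<open>The witness depends on \<open>u\<close>: it collects the indices where the untruncated
  power attains the minimum.\<close>

lemma J_trunc_eq_J_fixed: "\<exists>S. J_trunc r p T g u = J_fixed S r p T g u"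
  by (rule exI[of _ "{i. \<bar>u $ i\<bar> powr p \<le> r powr p}"])
     (auto simp: J_trunc_def J_fixed_def min_def intro!: sum.cong)

lemma J_fixed_attains_inf:
  fixes T :: "real ^ 'n \<Rightarrow> real ^ 'm" and V :: "(real ^ 'n) set"
  assumes "linear T" "subspace V" "1 \<le> p"
  obtains u where "u \<in> V" "\<And>v. v \<in> V \<Longrightarrow> J_fixed S r p T g u \<le> J_fixed S r p T g v"
proof -
  define A :: "real ^ 'n \<Rightarrow> (real ^ 'm) \<times> (real ^ 'n)"
    where "A u = (T u, \<chi> i. if i \<in> S then u $ i else 0)" for u
  define f :: "(real ^ 'm) \<times> (real ^ 'n) \<Rightarrow> real"
    where "f w = (norm (fst w - g))\<^sup>2 + (\<Sum>i\<in>UNIV. \<bar>snd w $ i\<bar> powr p)" for w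
  \<comment> \<open>Components outside \<open>S\<close> are zeroed by \<open>A\<close> and add
    \<open>0 powr p = 0\<close> to \<open>f\<close>; what remains does not depend on
    \<open>u\<close>.\<close>
  have J_eq: "J_fixed S r p T g u = f (A u) + (\<Sum>i\<in>UNIV. if i \<in> S then 0 else r powr p)" for u
    unfolding J_fixed_def f_def A_def
    by (auto simp: add.assoc sum.distrib[symmetric] intro!: sum.cong)
  have "linear A"
    unfolding A_def using assms(1)
    by (auto intro!: linearI simp: linear_add linear_scale vec_eq_iff)
  then have W: "subspace (A ` V)" using assms(2) by (rule linear_subspace_image)
  \<comment> \<open>In the constant, \<open>norm g\<close> comes from the triangle inequality, 1
    from the squared residual, and \<open>CARD('n)\<close> from a 1 per component in the l1
    bound.\<close>
  have bound: "norm w \<le> (norm g + 1 + real CARD('n)) + f w" for w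
  proof -
    have "norm w \<le> norm (fst w) + norm (snd w)"
      by (metis norm_Pair_le prod.collapse)
    moreover have "norm (fst w) \<le> norm g + norm (fst w - g)"
      by (metis norm_triangle_sub)
    moreover have "norm (fst w - g) \<le> 1 + (norm (fst w - g))\<^sup>2"
      using le_one_plus_powr[of "norm (fst w - g)" 2] by simp
    moreover have "norm (snd w) \<le> (\<Sum>i\<in>UNIV. \<bar>snd w $ i\<bar>)" by (rule norm_le_l1_cart)
    moreover have "\<dots> \<le> (\<Sum>i\<in>UNIV. 1 + \<bar>snd w $ i\<bar> powr p)"
      using assms(3) by (intro sum_mono le_one_plus_powr) auto
    ultimately show ?thesis by (simp add: f_def sum.distrib)
  qed
  have cont: "continuous_on (A ` V) f"
    unfolding f_def using assms(3) by (intro continuous_intros continuous_on_powr') auto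
  have ne: "A ` V \<noteq> {}" using subspace_0[OF W] by blast
  obtain w where w: "w \<in> A ` V" "\<And>v. v \<in> A ` V \<Longrightarrow> f w \<le> f v"
    by (rule attains_inf_coercive[OF closed_subspace[OF W] ne cont bound]) blast
  obtain u where u: "u \<in> V" "w = A u" using w(1) by blast
  show thesis
  proof (rule that[OF u(1)])
    fix v assume "v \<in> V"
    then show "J_fixed S r p T g u \<le> J_fixed S r p T g v"
      using w(2)[of "A v"] by (simp add: J_eq u(2))
  qed
qed

theorem theorem4p2p2:
  fixes T :: "real ^ 'n \<Rightarrow> real ^ 'm"
    and Q :: "real ^ 'n \<Rightarrow> real ^ 'k"
    and g :: "real ^ 'm"
    and r p :: real
  assumes "r > 0"
    and "linear T"
    and "linear Q"
    and "p \<ge> 1"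
  shows "\<exists>u. is_arg_min (J_trunc r p T g) (\<lambda>u. Q u = 0) u"
proof -
  let ?J = "\<lambda>S. J_fixed S r p T g"
  have "\<exists>u. Q u = 0 \<and> (\<forall>v. Q v = 0 \<longrightarrow> ?J S u \<le> ?J S v)" for S
  proof -
    obtain u where "u \<in> {u. Q u = 0}" "\<And>v. v \<in> {u. Q u = 0} \<Longrightarrow> ?J S u \<le> ?J S v"
      by (rule J_fixed_attains_inf[OF assms(2) linear_subspace_kernel[OF assms(3)] assms(4)]) blast
    then show ?thesis by auto
  qed
  then have "\<exists>m. \<forall>S. Q (m S) = 0 \<and> (\<forall>v. Q v = 0 \<longrightarrow> ?J S (m S) \<le> ?J S v)"
    by (intro choice allI)
  then obtain m where m: "\<And>S. Q (m S) = 0" "\<And>S v. Q v = 0 \<Longrightarrow> ?J S (m S) \<le> ?J S v"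
    by blast
  \<comment> \<open>There are only finitely many index sets, so one of the minimal values is
    smallest.\<close>
  have "\<exists>S0. is_arg_min (\<lambda>S. ?J S (m S)) (\<lambda>S. S \<in> UNIV) S0"
    by (intro ex_is_arg_min_if_finite) auto
  then obtain S0 where S0: "\<And>S. ?J S0 (m S0) \<le> ?J S (m S)"
    by (auto simp: is_arg_min_linorder)
  have "J_trunc r p T g (m S0) \<le> J_trunc r p T g v" if v: "Q v = 0" for v
  proof -
    \<comment> \<open>This \<open>S\<close> is adapted to the competitor \<open>v\<close>, while
      \<open>S0\<close> is fixed in advance.\<close>
    obtain S where S: "J_trunc r p T g v = ?J S v" using J_trunc_eq_J_fixed by blast
    have "J_trunc r p T g (m S0) \<le> ?J S0 (m S0)" by (rule J_trunc_le_J_fixed)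
    also have "\<dots> \<le> ?J S (m S)" by (rule S0)
    also have "\<dots> \<le> ?J S v" by (rule m(2)[OF v])
    finally show ?thesis by (simp add: S)
  qed
  then show ?thesis using m(1) by (auto simp: is_arg_min_linorder)
qed

end
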